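(* Let $R$ be a nonzero ring, let $n \in \mathbb{Z}^+$, and let $A_1,\dots,A_n$ be nonempty finite subsets of $R$, each satisfying Condition (D). Put $A = A_1\times\cdots\times A_n \subset R^n$. For each $i \in [n]$ let $b_i$ be an integer with $1 \le b_i \le \#A_i$. Let $f \in R[t_1,\dots,t_n]$ be a nonzero polynomial such that $\deg_{t_i} f \le \#A_i - b_i$ for all $i \in [n]$, and let $\mathcal{U}_A(f) = \{x \in A \mid f(x) \neq 0\}$. Then \[ \#\mathcal{U}_A(f) \ \ge\ \mathfrak{m}\Big(\#A_1,\dots,\#A_n;\, b_1,\dots,b_n;\, \sum_{i=1}^n \#A_i - \deg f\Big). \] Moreover, this bound is sharp in all cases: for all such $R$, $A_1,\dots,A_n$, $b_1,\dots,b_n$ and every integer $d$ with $0 \le d \le \sum_{i=1}^n (\#A_i - b_i)$, there is a nonzero polynomial $f \in R[t_1,\dots,t_n]$ with $\deg f = d$ and $\deg_{t_i} f \le \#A_i - b_i$ for all $i \in [n]$ such that $\#\mathcal{U}_A(f) = \mathfrak{m}(\#A_1,\dots,\#A_n; b_1,\dots,b_n; \sum_{i=1}^n \#A_i - d)$.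
   Context: Rings are commutative with $1$. $[n]=\{1,\dots,n\}$. An element $r \in R$ is a zero divisor if $rs=0$ for some nonzero $s \in R$. A nonempty subset $S \subset R$ satisfies Condition (D) if for all $x \ne y$ in $S$, the element $x-y$ is not a zero divisor in $R$. $\deg f$ is the total degree and $\deg_{t_i} f$ the degree in the variable $t_i$. Balls in prefilled bins: for positive integers $a_1,\dots,a_n$, integers $b_i$ with $1 \le b_i \le a_i$, and an integer $N$ with $\sum b_i \le N \le \sum a_i$, define $\mathfrak{m}(a_1,\dots,a_n;b_1,\dots,b_n;N)$ to be the minimum of $\prod_{i=1}^n y_i$ over all integer tuples $(y_1,\dots,y_n)$ with $b_i \le y_i \le a_i$ for all $i$ and $\sum_{i=1}^n y_i = N$. For $N < \sum_{i=1}^n b_i$ define $\mathfrak{m}(a_1,\dots,a_n;b_1,\dots,b_n;N) = \prod_{i=1}^n b_i$. *)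

theory Defs
  imports Main "HOL-Library.FuncSet" "HOL-Library.Poly_Mapping"
begin

definition zero_divisor :: "'a::comm_ring_1 \<Rightarrow> bool" where
  "zero_divisor r \<longleftrightarrow> (\<exists>s. s \<noteq> 0 \<and> r * s = 0)"

definition condition_D :: "'a::comm_ring_1 set \<Rightarrow> bool" where
  "condition_D S \<longleftrightarrow>
     S \<noteq> {} \<and> (\<forall>x\<in>S. \<forall>y\<in>S. x \<noteq> y \<longrightarrow> \<not> zero_divisor (x - y))"

(* Polynomials in the indeterminates t_i (i a natural number), as finitely supported
   functions from monomials, i.e. finitely supported exponent vectors, to coefficients. *)
type_synonym 'a mpoly = "(nat \<Rightarrow>\<^sub>0 nat) \<Rightarrow>\<^sub>0 'a"

(* R[t_1, ..., t_n] *)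
definition polys :: "nat \<Rightarrow> 'a::comm_ring_1 mpoly set" where
  "polys n = {f. \<forall>m \<in> Poly_Mapping.keys f. Poly_Mapping.keys m \<subseteq> {1..n}}"

definition eval_poly :: "(nat \<Rightarrow> 'a) \<Rightarrow> 'a::comm_ring_1 mpoly \<Rightarrow> 'a" where
  "eval_poly x f =
     (\<Sum>m \<in> Poly_Mapping.keys f. Poly_Mapping.lookup f m *
        (\<Prod>i \<in> Poly_Mapping.keys m. x i ^ Poly_Mapping.lookup m i))"

(* In both degrees, inserting 0 only affects the zero polynomial, whose degree is thereby 0. *)
definition total_deg :: "'a::comm_ring_1 mpoly \<Rightarrow> nat" where
  "total_deg f =
     Max (insert 0 ((\<lambda>m. \<Sum>i \<in> Poly_Mapping.keys m. Poly_Mapping.lookup m i) `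
       Poly_Mapping.keys f))"

definition deg_in :: "nat \<Rightarrow> 'a::comm_ring_1 mpoly \<Rightarrow> nat" where
  "deg_in i f = Max (insert 0 ((\<lambda>m. Poly_Mapping.lookup m i) ` Poly_Mapping.keys f))"

(* Points of A_1 \<times> ... \<times> A_n are the extensional functions on {1..n}. *)
definition nonzero_points :: "nat \<Rightarrow> (nat \<Rightarrow> 'a set) \<Rightarrow> 'a::comm_ring_1 mpoly \<Rightarrow> (nat \<Rightarrow> 'a) set" where
  "nonzero_points n A f = {x \<in> Pi\<^sub>E {1..n} A. eval_poly x f \<noteq> 0}"

(* Only meaningful for N \<le> a_1 + ... + a_n: beyond that the set under Min is empty. *)
definition prefilled_min :: "nat \<Rightarrow> (nat \<Rightarrow> int) \<Rightarrow> (nat \<Rightarrow> int) \<Rightarrow> int \<Rightarrow> int" where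
  "prefilled_min n a b N =
     (if N < (\<Sum>i=1..n. b i) then (\<Prod>i=1..n. b i)
      else Min {(\<Prod>i=1..n. y i) | y.
             y \<in> (\<Pi>\<^sub>E i\<in>{1..n}. {b i..a i}) \<and> (\<Sum>i=1..n. y i) = N})"

end

theory Submission
  imports Defs "HOL-Computational_Algebra.Polynomial"
begin

text \<open>
  Let \<open>t\<^sup>m\<close> be the lexicographically leading monomial of \<open>f\<close>, with \<open>t_n\<close> the most significant
  indeterminate. Condition (D) bounds the number of roots in \<open>A_n\<close> of a nonzero univariate
  polynomial by its degree; peeling off one indeterminate at a time shows that \<open>f\<close> has at least
  \<open>\<Prod> (#A_i - m_i)\<close> nonzeros on \<open>A\<close>. The numbers \<open>y_i = #A_i - m_i\<close> form an admissible tuple of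
  sum at least \<open>\<Sum> #A_i - deg f\<close>, and decreasing some entries makes the sum equal to that. For
  sharpness, start from a minimising tuple \<open>y\<close>, choose \<open>Z_i \<subseteq> A_i\<close> of size \<open>#A_i - y_i\<close>, and
  take \<open>f = \<Prod>\<^sub>i \<Prod>\<^bsub>z \<in> Z_i\<^esub> (t_i - z)\<close>.
\<close>

section \<open>Univariate roots under Condition (D)\<close>

text \<open>The factor is monic, so the top coefficient of \<open>q\<close> survives unchanged even
  when the ring has zero divisors.\<close>

lemma degree_linear_mult:
  fixes q :: "'a::comm_ring_1 poly"
  assumes "q \<noteq> 0"
  shows "degree ([:a, 1:] * q) = Suc (degree q)"
    and "lead_coeff ([:a, 1:] * q) = lead_coeff q"
proof -
  have top: "coeff ([:a, 1:] * q) (Suc (degree q)) = lead_coeff q"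
    using coeff_mult_degree_sum[of "[:a, 1:]" q] by simp
  have "degree ([:a, 1:] * q) \<le> Suc (degree q)"
    using degree_mult_le[of "[:a, 1:]" q] by simp
  moreover have "Suc (degree q) \<le> degree ([:a, 1:] * q)"
    by (rule le_degree) (use top assms in simp)
  ultimately show "degree ([:a, 1:] * q) = Suc (degree q)" by (rule antisym)
  with top show "lead_coeff ([:a, 1:] * q) = lead_coeff q" by simp
qed

text \<open>Divide out a root \<open>z\<close> in \<open>B\<close>. At any other root
  \<open>t\<close> in \<open>B\<close>, the difference \<open>t - z\<close> is not a zero divisor
  and cancels, so \<open>t\<close> is a root of the quotient, whose degree is one less.\<close>

lemma card_roots_le_degree:
  fixes p :: "'a::comm_ring_1 poly"
  assumes "finite B" "condition_D B" "p \<noteq> 0"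
  shows "card {t \<in> B. poly p t = 0} \<le> degree p"
  using assms(3)
proof (induction "degree p" arbitrary: p rule: less_induct)
  case less
  show ?case
  proof (cases "\<exists>z\<in>B. poly p z = 0")
    case False
    then have "{t \<in> B. poly p t = 0} = {}" by blast
    then show ?thesis by (metis card.empty le0)
  next
    case True
    then obtain z where z: "z \<in> B" "poly p z = 0" by blast
    then obtain q where q: "p = [:-z, 1:] * q"
      using poly_eq_0_iff_dvd by (metis dvdE)
    have "q \<noteq> 0" using q less.prems by auto
    then have deg: "degree p = Suc (degree q)"
      unfolding q by (rule degree_linear_mult)
    have "{t \<in> B. poly p t = 0} \<subseteq> insert z {t \<in> B. poly q t = 0}"
    proof
      fix t assume t: "t \<in> {t \<in> B. poly p t = 0}"
      then have "(t - z) * poly q t = 0" by (simp add: q algebra_simps)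
      with t z(1) assms(2) show "t \<in> insert z {t \<in> B. poly q t = 0}"
        unfolding condition_D_def zero_divisor_def by blast
    qed
    then have "card {t \<in> B. poly p t = 0} \<le> card (insert z {t \<in> B. poly q t = 0})"
      by (intro card_mono) (use assms(1) in auto)
    also have "\<dots> \<le> Suc (card {t \<in> B. poly q t = 0})"
      by (simp add: card_insert_le_m1 card_insert_if assms(1))
    also have "\<dots> \<le> degree p"
      using less.hyps[of q] deg \<open>q \<noteq> 0\<close> by simp
    finally show ?thesis .
  qed
qed

section \<open>Counting nonzeros by a leading monomial\<close>

text \<open>
  The exponents in \<open>S\<close> may involve indeterminates beyond \<open>t_n\<close>, so that the monomials of the leading
  coefficient can be kept as a subset of \<open>S\<close> in the induction on \<open>n\<close>.
\<close>

lemma footprint_bound_aux: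
  fixes c :: "(nat \<Rightarrow>\<^sub>0 nat) \<Rightarrow> 'a::comm_ring_1"
  assumes "finite S" "S \<noteq> {}" "\<And>m. m \<in> S \<Longrightarrow> c m \<noteq> 0"
    and "inj_on (\<lambda>m. restrict (Poly_Mapping.lookup m) {1..n}) S"
    and "\<And>i. i \<in> {1..n} \<Longrightarrow> finite (A i)"
    and "\<And>i. i \<in> {1..n} \<Longrightarrow> condition_D (A i)"
  shows "\<exists>m\<in>S. (\<Prod>i=1..n. card (A i) - Poly_Mapping.lookup m i) \<le>
    card {x \<in> Pi\<^sub>E {1..n} A. (\<Sum>m\<in>S. c m * (\<Prod>i=1..n. x i ^ Poly_Mapping.lookup m i)) \<noteq> 0}"
  using assms
proof (induction n arbitrary: S)
  case 0
  from "0.prems"(2) obtain m where m: "m \<in> S" by blast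
  \<comment> \<open>\<open>{1..0}\<close> is empty, so all restrictions coincide and injectivity
    leaves a single monomial.\<close>
  have "m' = m" if "m' \<in> S" for m'
    using "0.prems"(4) m that by (auto simp: inj_on_def restrict_def)
  with m have "S = {m}" by blast
  with "0.prems"(3) m show ?case by simp
next
  case (Suc n)
  \<comment> \<open>\<open>k\<close> is the highest exponent of the last indeterminate, and
    \<open>S'\<close> collects the monomials of the coefficient of its \<open>k\<close>-th
    power.\<close>
  define k where "k = Max ((\<lambda>m. Poly_Mapping.lookup m (Suc n)) ` S)"
  define S' where "S' = {m \<in> S. Poly_Mapping.lookup m (Suc n) = k}"
  define g where "g T n x = (\<Sum>m\<in>T. c m * (\<Prod>i=1..n. x i ^ Poly_Mapping.lookup m i))" for T n x
  define U where "U = {x \<in> Pi\<^sub>E {1..n} A. g S' n x \<noteq> 0}"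
  define V where "V = {x \<in> Pi\<^sub>E {1..Suc n} A. g S (Suc n) x \<noteq> 0}"
  have k_ge: "Poly_Mapping.lookup m (Suc n) \<le> k" if "m \<in> S" for m
    using that Suc.prems(1) by (simp add: k_def)
  have "k \<in> (\<lambda>m. Poly_Mapping.lookup m (Suc n)) ` S"
    unfolding k_def by (rule Max_in) (use Suc.prems in auto)
  then have "S' \<noteq> {}" by (auto simp: S'_def)
  \<comment> \<open>On \<open>S'\<close> the last exponent is constantly \<open>k\<close>, so the
    first \<open>n\<close> exponents still separate monomials.\<close>
  have inj: "inj_on (\<lambda>m. restrict (Poly_Mapping.lookup m) {1..n}) S'"
  proof (rule inj_onI)
    fix m m' assume mm: "m \<in> S'" "m' \<in> S'"
      and eq: "restrict (Poly_Mapping.lookup m) {1..n}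
        = restrict (Poly_Mapping.lookup m') {1..n}"
    have "Poly_Mapping.lookup m i = Poly_Mapping.lookup m' i" if "i \<in> {1..Suc n}" for i
    proof (cases "i = Suc n")
      case False
      then show ?thesis using fun_cong[OF eq, of i] that by (auto simp: restrict_def)
    qed (use mm in \<open>simp add: S'_def\<close>)
    then have "restrict (Poly_Mapping.lookup m) {1..Suc n}
        = restrict (Poly_Mapping.lookup m') {1..Suc n}"
      by (rule restrict_ext)
    then show "m = m'"
      using inj_onD[OF Suc.prems(4), of m m'] mm unfolding S'_def by blast
  qed
  then obtain m where m: "m \<in> S'" "(\<Prod>i=1..n. card (A i) - Poly_Mapping.lookup m i) \<le> card U"
  proof -
    have "\<exists>m\<in>S'. (\<Prod>i=1..n. card (A i) - Poly_Mapping.lookup m i) \<le> card U"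
      unfolding U_def g_def
    proof (rule Suc.IH[OF _ \<open>S' \<noteq> {}\<close> _ inj])
      show "finite S'" using Suc.prems(1) by (simp add: S'_def)
      show "c m \<noteq> 0" if "m \<in> S'" for m using Suc.prems(3) that by (simp add: S'_def)
      show "finite (A i)" "condition_D (A i)" if "i \<in> {1..n}" for i
        using Suc.prems(5,6)[of i] that by auto
    qed
    then show ?thesis using that by blast
  qed
  have fin: "finite (A (Suc n))" "finite (Pi\<^sub>E {1..n} A)" "finite (Pi\<^sub>E {1..Suc n} A)"
    using Suc.prems(5) by (auto intro!: finite_PiE)
  \<comment> \<open>The fibre of \<open>V\<close> above the point \<open>x\<close>.\<close>
  define W where "W x = {t \<in> A (Suc n). g S (Suc n) (x(Suc n := t)) \<noteq> 0}" for x
  have W: "card (A (Suc n)) - k \<le> card (W x)" if "x \<in> U" for x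
  proof -
    \<comment> \<open>The polynomial in the last indeterminate left after substituting
      \<open>x\<close> for the others. Its coefficient at \<open>k\<close> is nonzero because
      \<open>x\<close> lies in \<open>U\<close>, so it has at most \<open>k\<close> roots in
      \<open>A (Suc n)\<close>.\<close>
    define p where "p = (\<Sum>m\<in>S.
      monom (c m * (\<Prod>i=1..n. x i ^ Poly_Mapping.lookup m i)) (Poly_Mapping.lookup m (Suc n)))"
    have "coeff p k = g S' n x"
      unfolding p_def g_def S'_def coeff_sum coeff_monom
      using Suc.prems(1) by (subst sum.inter_filter) auto
    with that have "p \<noteq> 0" by (auto simp: U_def)
    have "degree p \<le> k"
      unfolding p_def using k_ge
      by (intro degree_sum_le Suc.prems(1)) (meson degree_monom_le le_trans)
    have upd: "g S (Suc n) (x(Suc n := t)) = poly p t" for t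
      unfolding g_def p_def poly_sum poly_monom
      by (intro sum.cong refl) (simp add: mult_ac)
    have "W x = A (Suc n) - {t \<in> A (Suc n). poly p t = 0}"
      unfolding W_def upd by auto
    then have "card (W x) = card (A (Suc n)) - card {t \<in> A (Suc n). poly p t = 0}"
      using fin(1) by (simp add: card_Diff_subset)
    moreover have "card {t \<in> A (Suc n). poly p t = 0} \<le> k"
    proof (rule le_trans[OF card_roots_le_degree \<open>degree p \<le> k\<close>])
      show "condition_D (A (Suc n))" by (rule Suc.prems(6)) simp
    qed (use fin(1) \<open>p \<noteq> 0\<close> in auto)
    ultimately show ?thesis by simp
  qed
  have "(\<Prod>i=1..Suc n. card (A i) - Poly_Mapping.lookup m i) \<le> card U * (card (A (Suc n)) - k)"
    using m by (simp add: S'_def)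
  also have "\<dots> \<le> (\<Sum>x\<in>U. card (W x))"
    using sum_mono[OF W, of U "\<lambda>x. x"] by simp
  also have "\<dots> = card (SIGMA x:U. W x)"
    by (rule card_SigmaI[symmetric]) (use fin in \<open>auto simp: U_def W_def\<close>)
  also have "\<dots> \<le> card V"
  proof (rule card_inj_on_le)
    show "inj_on (\<lambda>(x, t). x(Suc n := t)) (SIGMA x:U. W x)"
    proof (rule inj_onI, clarify)
      fix x t x' t'
      assume xt: "x \<in> U" "x' \<in> U" and eq: "x(Suc n := t) = x'(Suc n := t')"
      \<comment> \<open>Points of \<open>U\<close> are extensional on \<open>{1..n}\<close>, so
        resetting the last coordinate to \<open>undefined\<close> recovers them.\<close>
      have "x = (x(Suc n := t))(Suc n := undefined)"
        "x' = (x'(Suc n := t'))(Suc n := undefined)"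
        using xt by (auto simp: U_def fun_eq_iff PiE_def extensional_def)
      with eq show "x = x' \<and> t = t'" by (metis fun_upd_same)
    qed
    show "(\<lambda>(x, t). x(Suc n := t)) ` (SIGMA x:U. W x) \<subseteq> V"
      by (auto simp: U_def V_def W_def PiE_def extensional_def Pi_def)
    show "finite V" using fin(3) by (simp add: V_def)
  qed
  finally show ?case
    using m(1) unfolding V_def g_def S'_def by blast
qed

text \<open>Added monomials have coefficient 0 and added indeterminates exponent 0, so fixed index
  sets can replace the supports.\<close>

lemma eval_poly_superset:
  assumes "finite T" "Poly_Mapping.keys f \<subseteq> T" "\<And>m. m \<in> T \<Longrightarrow> Poly_Mapping.keys m \<subseteq> {1..n}"
  shows "eval_poly x f =
    (\<Sum>m\<in>T. Poly_Mapping.lookup f m * (\<Prod>i=1..n. x i ^ Poly_Mapping.lookup m i))"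
proof -
  have "(\<Prod>i\<in>Poly_Mapping.keys m. x i ^ Poly_Mapping.lookup m i) =
      (\<Prod>i=1..n. x i ^ Poly_Mapping.lookup m i)" if "m \<in> T" for m
    by (rule prod.mono_neutral_left) (use assms(3)[OF that] in \<open>auto simp: in_keys_iff\<close>)
  then have "eval_poly x f =
      (\<Sum>m\<in>Poly_Mapping.keys f. Poly_Mapping.lookup f m * (\<Prod>i=1..n. x i ^ Poly_Mapping.lookup m i))"
    unfolding eval_poly_def using assms(2) by (intro sum.cong) auto
  also have "\<dots> = (\<Sum>m\<in>T. Poly_Mapping.lookup f m * (\<Prod>i=1..n. x i ^ Poly_Mapping.lookup m i))"
    by (rule sum.mono_neutral_left) (use assms in \<open>auto simp: in_keys_iff\<close>)
  finally show ?thesis .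
qed

text \<open>All monomials of \<open>f\<close> together serve as the set \<open>S\<close> of
  \<open>footprint_bound_aux\<close>: supported in \<open>{1..n}\<close>, they are determined by
  their restrictions.\<close>

lemma footprint_bound:
  fixes f :: "'a::comm_ring_1 mpoly"
  assumes "f \<in> polys n" "f \<noteq> 0"
    and "\<And>i. i \<in> {1..n} \<Longrightarrow> finite (A i)"
    and "\<And>i. i \<in> {1..n} \<Longrightarrow> condition_D (A i)"
  shows "\<exists>m\<in>Poly_Mapping.keys f. (\<Prod>i=1..n. card (A i) - Poly_Mapping.lookup m i)
    \<le> card (nonzero_points n A f)"
proof -
  have sub: "Poly_Mapping.keys m \<subseteq> {1..n}" if "m \<in> Poly_Mapping.keys f" for m
    using assms(1) that by (auto simp: polys_def)
  have "inj_on (\<lambda>m. restrict (Poly_Mapping.lookup m) {1..n}) (Poly_Mapping.keys f)"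
  proof (rule inj_onI)
    fix m m' assume mm: "m \<in> Poly_Mapping.keys f" "m' \<in> Poly_Mapping.keys f"
      and eq: "restrict (Poly_Mapping.lookup m) {1..n}
        = restrict (Poly_Mapping.lookup m') {1..n}"
    show "m = m'"
    proof (rule poly_mapping_eqI)
      fix i show "Poly_Mapping.lookup m i = Poly_Mapping.lookup m' i"
      proof (cases "i \<in> {1..n}")
        case True
        then show ?thesis using fun_cong[OF eq, of i] by (simp add: restrict_def)
      next
        case False
        then show ?thesis using sub[OF mm(1)] sub[OF mm(2)] by (metis in_keys_iff subsetD)
      qed
    qed
  qed
  moreover have "eval_poly x f = (\<Sum>m\<in>Poly_Mapping.keys f.
      Poly_Mapping.lookup f m * (\<Prod>i=1..n. x i ^ Poly_Mapping.lookup m i))" for x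
    by (rule eval_poly_superset[OF finite_keys subset_refl sub])
  ultimately show ?thesis
    unfolding nonzero_points_def
    using assms footprint_bound_aux[of "Poly_Mapping.keys f" "Poly_Mapping.lookup f" n A]
    by (simp add: in_keys_iff)
qed

lemma deg_in_ge: "m \<in> Poly_Mapping.keys f \<Longrightarrow> Poly_Mapping.lookup m i \<le> deg_in i f"
  by (simp add: deg_in_def)

lemma total_deg_ge:
  assumes "f \<in> polys n" "m \<in> Poly_Mapping.keys f"
  shows "(\<Sum>i=1..n. Poly_Mapping.lookup m i) \<le> total_deg f"
proof -
  have "(\<Sum>i=1..n. Poly_Mapping.lookup m i) = (\<Sum>i\<in>Poly_Mapping.keys m. Poly_Mapping.lookup m i)"
    by (rule sum.mono_neutral_right) (use assms in \<open>auto simp: polys_def in_keys_iff\<close>)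
  also have "\<dots> \<le> total_deg f"
    using assms(2) by (simp add: total_deg_def)
  finally show ?thesis .
qed

section \<open>Balls in prefilled bins\<close>

text \<open>A discrete intermediate value property, proved by filling one bin at a time.\<close>

lemma exists_sum_between:
  fixes b y :: "'i \<Rightarrow> int"
  assumes "finite I" "\<And>i. i \<in> I \<Longrightarrow> b i \<le> y i" "sum b I \<le> N" "N \<le> sum y I"
  shows "\<exists>z. (\<forall>i\<in>I. b i \<le> z i \<and> z i \<le> y i) \<and> sum z I = N"
  using assms
proof (induction I arbitrary: N)
  case (insert j I)
  \<comment> \<open>The least value for bin \<open>j\<close> that leaves no more than the other bins
    can hold.\<close>
  define v where "v = max (b j) (N - sum y I)"
  have "sum b I \<le> sum y I" using insert by (intro sum_mono) auto
  then have "sum b I \<le> N - v" "N - v \<le> sum y I"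
    using insert by (auto simp: v_def)
  then obtain z where z: "\<forall>i\<in>I. b i \<le> z i \<and> z i \<le> y i" "sum z I = N - v"
    using insert.IH[of "N - v"] insert.prems by auto
  have "sum (z(j := v)) (insert j I) = N"
  proof -
    have "sum (z(j := v)) I = sum z I" using insert.hyps by (intro sum.cong) auto
    then show ?thesis using insert.hyps z by simp
  qed
  moreover have "b j \<le> v" "v \<le> y j"
    using insert by (auto simp: v_def)
  ultimately show ?case using z(1) insert.hyps by (intro exI[of _ "z(j := v)"]) auto
qed simp

lemma finite_prefilled:
  fixes a b :: "nat \<Rightarrow> int"
  shows "finite {(\<Prod>i=1..n. y i) | y.
    y \<in> (\<Pi>\<^sub>E i\<in>{1..n}. {b i..a i}) \<and> (\<Sum>i=1..n. y i) = N}" (is "finite ?M")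
proof (rule finite_subset)
  show "?M \<subseteq> (\<lambda>y. \<Prod>i=1..n. y i) ` (\<Pi>\<^sub>E i\<in>{1..n}. {b i..a i})" by auto
  show "finite ((\<lambda>y. \<Prod>i=1..n. y i) ` (\<Pi>\<^sub>E i\<in>{1..n}. {b i..a i}))"
    by (intro finite_imageI finite_PiE) auto
qed

text \<open>Lowering \<open>y\<close> to a tuple of sum exactly \<open>N\<close> that stays above
  \<open>b\<close> cannot increase a product of nonnegative factors. If \<open>N\<close> is below
  the sum of \<open>b\<close>, the tuple \<open>b\<close> itself is the comparison.\<close>

lemma prefilled_min_le_prod:
  fixes a b y :: "nat \<Rightarrow> int"
  assumes "\<And>i. i \<in> {1..n} \<Longrightarrow> 0 \<le> b i \<and> b i \<le> y i \<and> y i \<le> a i"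
    and "N \<le> (\<Sum>i=1..n. y i)"
  shows "prefilled_min n a b N \<le> (\<Prod>i=1..n. y i)"
proof (cases "N < (\<Sum>i=1..n. b i)")
  case True
  then show ?thesis
    unfolding prefilled_min_def using assms(1) by (auto intro!: prod_mono)
next
  case False
  then obtain z where z: "\<forall>i\<in>{1..n}. b i \<le> z i \<and> z i \<le> y i" "sum z {1..n} = N"
    using exists_sum_between[of "{1..n}" b y N] assms by auto
  let ?z = "restrict z {1..n}"
  have mem: "?z \<in> (\<Pi>\<^sub>E i\<in>{1..n}. {b i..a i})"
    using z(1) assms(1) by (fastforce simp: PiE_def)
  have "prefilled_min n a b N \<le> (\<Prod>i=1..n. ?z i)"
    unfolding prefilled_min_def if_not_P[OF False]
  proof (rule Min_le[OF finite_prefilled], clarify)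
    show "\<exists>y. (\<Prod>i=1..n. ?z i) = (\<Prod>i=1..n. y i) \<and>
      y \<in> (\<Pi>\<^sub>E i\<in>{1..n}. {b i..a i}) \<and> (\<Sum>i=1..n. y i) = N"
      using mem z(2) by (intro exI[of _ ?z]) auto
  qed
  also have "\<dots> \<le> (\<Prod>i=1..n. y i)"
    by (rule prod_mono) (use z assms(1) in fastforce)
  finally show ?thesis .
qed

text \<open>The bounds on \<open>N\<close> select the \<open>Min\<close> branch and make its finite
  set nonempty.\<close>

lemma prefilled_min_attained:
  fixes a b :: "nat \<Rightarrow> int"
  assumes "\<And>i. i \<in> {1..n} \<Longrightarrow> b i \<le> a i"
    and "(\<Sum>i=1..n. b i) \<le> N" "N \<le> (\<Sum>i=1..n. a i)"
  obtains y where "\<And>i. i \<in> {1..n} \<Longrightarrow> b i \<le> y i \<and> y i \<le> a i"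
    "(\<Sum>i=1..n. y i) = N" "prefilled_min n a b N = (\<Prod>i=1..n. y i)"
proof -
  let ?M = "{(\<Prod>i=1..n. y i) | y.
    y \<in> (\<Pi>\<^sub>E i\<in>{1..n}. {b i..a i}) \<and> (\<Sum>i=1..n. y i) = N}"
  obtain z where z: "\<forall>i\<in>{1..n}. b i \<le> z i \<and> z i \<le> a i" "sum z {1..n} = N"
    using exists_sum_between[of "{1..n}" b a N] assms by auto
  have "(\<Prod>i=1..n. restrict z {1..n} i) \<in> ?M"
    using z by (intro CollectI exI[of _ "restrict z {1..n}"]) auto
  then have "Min ?M \<in> ?M"
    by (intro Min_in finite_prefilled) blast
  then obtain y where "y \<in> (\<Pi>\<^sub>E i\<in>{1..n}. {b i..a i})" "(\<Sum>i=1..n. y i) = N"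
    "Min ?M = (\<Prod>i=1..n. y i)"
    by auto
  with assms(2) that[of y] show ?thesis
    unfolding prefilled_min_def by (auto simp: PiE_def Pi_def)
qed

section \<open>Polynomials attaining the bound\<close>

text \<open>The product of the \<open>p i\<close> in separate indeterminates, given directly by its
  coefficients. Monic factors ensure that the product of the top powers occurs, which fixes the
  total degree.\<close>

lemma exists_mpoly_prod:
  fixes p :: "nat \<Rightarrow> 'a::comm_ring_1 poly"
  assumes "\<And>i. i \<in> {1..n} \<Longrightarrow> lead_coeff (p i) = 1"
  obtains f :: "'a mpoly" where "f \<in> polys n" "f \<noteq> 0"
    "total_deg f = (\<Sum>i=1..n. degree (p i))"
    "\<And>i. i \<in> {1..n} \<Longrightarrow> deg_in i f \<le> degree (p i)"
    "\<And>x. eval_poly x f = (\<Prod>i=1..n. poly (p i) (x i))"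
proof -
  \<comment> \<open>\<open>B\<close> and \<open>P\<close> are the same box of exponents, as finitely
    supported maps and as extensional functions; \<open>\<phi>\<close> and \<open>\<psi>\<close>
    translate between them.\<close>
  define B :: "(nat \<Rightarrow>\<^sub>0 nat) set"
    where "B = {m. Poly_Mapping.keys m \<subseteq> {1..n} \<and>
      (\<forall>i\<in>{1..n}. Poly_Mapping.lookup m i \<le> degree (p i))}"
  define P where "P = (\<Pi>\<^sub>E i\<in>{1..n}. {..degree (p i)})"
  define \<phi> :: "(nat \<Rightarrow>\<^sub>0 nat) \<Rightarrow> nat \<Rightarrow> nat"
    where "\<phi> m = restrict (Poly_Mapping.lookup m) {1..n}" for m
  define \<psi> :: "(nat \<Rightarrow> nat) \<Rightarrow> nat \<Rightarrow>\<^sub>0 nat"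
    where "\<psi> h = Abs_poly_mapping (\<lambda>i. if i \<in> {1..n} then h i else 0)" for h
  have lookup_\<psi>: "Poly_Mapping.lookup (\<psi> h) i = (if i \<in> {1..n} then h i else 0)" for h i
  proof -
    have "finite {i. (if i \<in> {1..n} then h i else 0) \<noteq> 0}"
      by (rule finite_subset[of _ "{1..n}"]) auto
    then show ?thesis unfolding \<psi>_def by (simp add: lookup_Abs_poly_mapping)
  qed
  have lookup_outside: "Poly_Mapping.lookup m i = 0" if "m \<in> B" "i \<notin> {1..n}" for m i
    using that by (auto simp: B_def in_keys_iff)
  have \<phi>\<psi>: "bij_betw \<phi> B P"
  proof (rule bij_betw_byWitness[where f' = \<psi>])
    show "\<forall>m\<in>B. \<psi> (\<phi> m) = m"
      using lookup_outside by (auto intro!: poly_mapping_eqI simp: lookup_\<psi> \<phi>_def)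
    show "\<forall>h\<in>P. \<phi> (\<psi> h) = h"
      by (auto simp: \<phi>_def P_def lookup_\<psi> fun_eq_iff PiE_def extensional_def restrict_def)
    show "\<phi> ` B \<subseteq> P" by (auto simp: \<phi>_def P_def B_def)
    show "\<psi> ` P \<subseteq> B"
      by (auto simp: B_def P_def in_keys_iff lookup_\<psi> PiE_def Pi_def split: if_splits)
  qed
  have "finite P" unfolding P_def by (intro finite_PiE) auto
  then have "finite B" using \<phi>\<psi> bij_betw_finite by blast
  define F
    where "F m = (if m \<in> B then \<Prod>i=1..n. coeff (p i) (Poly_Mapping.lookup m i) else 0)" for m
  define f where "f = Abs_poly_mapping F"
  have "finite {m. F m \<noteq> 0}"
    by (rule finite_subset[OF _ \<open>finite B\<close>]) (auto simp: F_def)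
  then have lookup_f: "Poly_Mapping.lookup f = F"
    unfolding f_def by (simp add: lookup_Abs_poly_mapping)
  have keys_f: "Poly_Mapping.keys f \<subseteq> B"
    by (auto simp: in_keys_iff lookup_f F_def split: if_splits)
  \<comment> \<open>The top corner of the box, where the coefficient is a product of leading
    coefficients, hence 1.\<close>
  define e where "e = \<psi> (\<lambda>i. degree (p i))"
  have "e \<in> B" by (auto simp: e_def B_def in_keys_iff lookup_\<psi> split: if_splits)
  moreover have "(\<Prod>i=1..n. coeff (p i) (Poly_Mapping.lookup e i)) = 1"
    using assms by (intro prod.neutral) (simp add: e_def lookup_\<psi>)
  ultimately have e: "e \<in> Poly_Mapping.keys f" by (simp add: in_keys_iff lookup_f F_def)
  have poly_f: "f \<in> polys n" using keys_f by (auto simp: polys_def B_def)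
  show thesis
  proof
    show "f \<in> polys n" by (fact poly_f)
    show "f \<noteq> 0" using e by auto
    show "total_deg f = (\<Sum>i=1..n. degree (p i))"
    proof (rule antisym)
      have "(\<Sum>i\<in>Poly_Mapping.keys m. Poly_Mapping.lookup m i) \<le> (\<Sum>i=1..n. degree (p i))"
        if "m \<in> Poly_Mapping.keys f" for m
      proof -
        have "(\<Sum>i\<in>Poly_Mapping.keys m. Poly_Mapping.lookup m i)
            \<le> (\<Sum>i\<in>Poly_Mapping.keys m. degree (p i))"
          using that keys_f by (intro sum_mono) (auto simp: B_def)
        also have "\<dots> \<le> (\<Sum>i=1..n. degree (p i))"
          using that keys_f by (intro sum_mono2) (auto simp: B_def)
        finally show ?thesis .
      qed
      then show "total_deg f \<le> (\<Sum>i=1..n. degree (p i))" by (simp add: total_deg_def)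
      show "(\<Sum>i=1..n. degree (p i)) \<le> total_deg f"
        using total_deg_ge[OF poly_f e] by (simp add: e_def lookup_\<psi>)
    qed
    show "deg_in i f \<le> degree (p i)" if "i \<in> {1..n}" for i
      using that keys_f by (auto simp: deg_in_def B_def)
    show "eval_poly x f = (\<Prod>i=1..n. poly (p i) (x i))" for x
    proof -
      have "eval_poly x f =
          (\<Sum>m\<in>B. Poly_Mapping.lookup f m * (\<Prod>i=1..n. x i ^ Poly_Mapping.lookup m i))"
        by (rule eval_poly_superset[OF \<open>finite B\<close> keys_f]) (auto simp: B_def)
      also have "\<dots> = (\<Sum>m\<in>B. \<Prod>i=1..n. coeff (p i) (\<phi> m i) * x i ^ \<phi> m i)"
        by (intro sum.cong refl) (simp add: lookup_f F_def \<phi>_def prod.distrib)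
      also have "\<dots> = (\<Sum>h\<in>P. \<Prod>i=1..n. coeff (p i) (h i) * x i ^ h i)"
        by (rule sum.reindex_bij_betw[OF \<phi>\<psi>])
      \<comment> \<open>Distributivity: a product of sums expands over all choices of one exponent
        per indeterminate.\<close>
      also have "\<dots> = (\<Prod>i=1..n. poly (p i) (x i))"
        unfolding P_def poly_altdef by (rule prod_sum_PiE[symmetric]) auto
      finally show ?thesis .
    qed
  qed
qed

text \<open>The factors cancel one after another. Merely nonzero factors could have product 0 in
  this generality.\<close>

lemma not_zero_divisor_prod:
  fixes f :: "'i \<Rightarrow> 'a::comm_ring_1"
  assumes "\<And>i. i \<in> I \<Longrightarrow> \<not> zero_divisor (f i)"
  shows "\<not> zero_divisor (prod f I)"
  using assms
proof (induction I rule: infinite_finite_induct)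
  case (insert i I)
  have "s = 0" if "(f i * prod f I) * s = 0" for s
    using that insert.prems[of i] insert.IH insert.prems
    unfolding zero_divisor_def by (metis insert_iff mult.assoc)
  with insert.hyps show ?case by (auto simp: zero_divisor_def)
qed (auto simp: zero_divisor_def)

text \<open>Since \<open>1 \<noteq> 0\<close> in the ring, 0 is itself a zero divisor.\<close>

lemma not_zero_divisor_nonzero: "\<not> zero_divisor r \<Longrightarrow> r \<noteq> 0"
  unfolding zero_divisor_def by (metis mult_zero_left zero_neq_one)

text \<open>A product of linear factors \<open>t_i - z\<close> with \<open>z\<close> in a chosen
  \<open>Z i\<close> of size \<open>e i\<close> is nonzero exactly on the box of the sets
  \<open>A i - Z i\<close>.\<close>

lemma exists_card_nonzero_points:
  fixes A :: "nat \<Rightarrow> 'a::comm_ring_1 set"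
  assumes "\<And>i. i \<in> {1..n} \<Longrightarrow> finite (A i)"
    and "\<And>i. i \<in> {1..n} \<Longrightarrow> condition_D (A i)"
    and "\<And>i. i \<in> {1..n} \<Longrightarrow> e i \<le> card (A i)"
  obtains f :: "'a mpoly" where "f \<in> polys n" "f \<noteq> 0"
    "total_deg f = (\<Sum>i=1..n. e i)"
    "\<And>i. i \<in> {1..n} \<Longrightarrow> deg_in i f \<le> e i"
    "card (nonzero_points n A f) = (\<Prod>i=1..n. card (A i) - e i)"
proof -
  have "\<exists>Z. Z \<subseteq> A i \<and> card Z = e i" if "i \<in> {1..n}" for i
    using obtain_subset_with_card_n[OF assms(3)[OF that]] by blast
  then obtain Z where Z: "\<And>i. i \<in> {1..n} \<Longrightarrow> Z i \<subseteq> A i \<and> card (Z i) = e i" by metis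
  define p where "p i = (\<Prod>z\<in>Z i. [:-z, 1:])" for i
  have finZ: "finite (Z i)" if "i \<in> {1..n}" for i
    using Z assms(1) that finite_subset by blast
  have p: "degree (p i) = e i \<and> lead_coeff (p i) = 1" if "i \<in> {1..n}" for i
  proof -
    have "degree (\<Prod>z\<in>T. [:-z, 1:]) = card T \<and> lead_coeff (\<Prod>z\<in>T. [:-z, 1:]) = 1"
      if "finite T" for T :: "'a set"
      using that
    proof induction
      case (insert z T)
      have "(\<Prod>z\<in>T. [:-z, 1:]) \<noteq> 0" using insert.IH by auto
      note lin = degree_linear_mult[OF this, of "-z"]
      show ?case
        unfolding prod.insert[OF insert.hyps] card_insert_disjoint[OF insert.hyps]
      proof
        show "degree ([:-z, 1:] * (\<Prod>z\<in>T. [:-z, 1:])) = Suc (card T)"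
          by (rule trans[OF lin(1)]) (use insert.IH in simp)
        show "lead_coeff ([:-z, 1:] * (\<Prod>z\<in>T. [:-z, 1:])) = 1"
          by (rule trans[OF lin(2)]) (use insert.IH in blast)
      qed
    qed simp
    then show ?thesis using finZ[OF that] Z[OF that] unfolding p_def by metis
  qed
  obtain f :: "'a mpoly" where f: "f \<in> polys n" "f \<noteq> 0"
    "total_deg f = (\<Sum>i=1..n. degree (p i))"
    "\<And>i. i \<in> {1..n} \<Longrightarrow> deg_in i f \<le> degree (p i)"
    "\<And>x. eval_poly x f = (\<Prod>i=1..n. poly (p i) (x i))"
  proof (rule exists_mpoly_prod[of n p])
    show "lead_coeff (p i) = 1" if "i \<in> {1..n}" for i using p[OF that] by blast
  qed (rule that)
  have "nonzero_points n A f = (\<Pi>\<^sub>E i\<in>{1..n}. A i - Z i)"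
  proof (intro set_eqI iffI)
    fix x assume x: "x \<in> nonzero_points n A f"
    have "x i \<notin> Z i" if "i \<in> {1..n}" for i
    proof
      assume "x i \<in> Z i"
      then have "poly (p i) (x i) = 0"
        unfolding p_def poly_prod using finZ[OF that] by (intro prod_zero) auto
      then have "eval_poly x f = 0"
        unfolding f(5) using that by (intro prod_zero) auto
      with x show False by (simp add: nonzero_points_def)
    qed
    with x show "x \<in> (\<Pi>\<^sub>E i\<in>{1..n}. A i - Z i)"
      by (auto simp: nonzero_points_def PiE_def Pi_def)
  next
    fix x assume x: "x \<in> (\<Pi>\<^sub>E i\<in>{1..n}. A i - Z i)"
    \<comment> \<open>Off the \<open>Z i\<close>, Condition (D) makes every linear factor a
      non-zero-divisor, which is what lets the whole product be nonzero.\<close>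
    have "\<not> zero_divisor (x i - z)" if "i \<in> {1..n}" "z \<in> Z i" for i z
    proof -
      have "x i \<in> A i - Z i" using x that(1) by (rule PiE_mem)
      moreover have "z \<in> A i" using Z[OF that(1)] that(2) by auto
      ultimately show ?thesis
        using assms(2)[OF that(1)] that(2) by (auto simp: condition_D_def)
    qed
    then have "\<not> zero_divisor (eval_poly x f)"
      unfolding f(5) p_def poly_prod by (intro not_zero_divisor_prod) auto
    then show "x \<in> nonzero_points n A f"
      using x not_zero_divisor_nonzero by (auto simp: nonzero_points_def PiE_def Pi_def)
  qed
  then have "card (nonzero_points n A f) = (\<Prod>i=1..n. card (A i - Z i))"
    by (simp add: card_PiE)
  also have "\<dots> = (\<Prod>i=1..n. card (A i) - e i)"
    using Z finZ by (intro prod.cong refl) (simp add: card_Diff_subset)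
  finally show thesis using that[of f] f p by simp
qed

theorem theorem1p2:
  fixes n :: nat
    and A :: "nat \<Rightarrow> 'a::comm_ring_1 set"
    and b :: "nat \<Rightarrow> int"
  assumes "n \<ge> 1"
    and "\<And>i. i \<in> {1..n} \<Longrightarrow> finite (A i)"
    and "\<And>i. i \<in> {1..n} \<Longrightarrow> A i \<noteq> {}"
    and "\<And>i. i \<in> {1..n} \<Longrightarrow> condition_D (A i)"
    and "\<And>i. i \<in> {1..n} \<Longrightarrow> 1 \<le> b i \<and> b i \<le> int (card (A i))"
  shows
    "(\<forall>f :: 'a mpoly. f \<in> polys n \<and> f \<noteq> 0 \<and>
        (\<forall>i\<in>{1..n}. int (deg_in i f) \<le> int (card (A i)) - b i) \<longrightarrow>
        int (card (nonzero_points n A f)) \<ge>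
          prefilled_min n (\<lambda>i. int (card (A i))) b
            ((\<Sum>i=1..n. int (card (A i))) - int (total_deg f))) \<and>
     (\<forall>d :: int. 0 \<le> d \<and> d \<le> (\<Sum>i=1..n. int (card (A i)) - b i) \<longrightarrow>
        (\<exists>f :: 'a mpoly. f \<in> polys n \<and> f \<noteq> 0 \<and> int (total_deg f) = d \<and>
          (\<forall>i\<in>{1..n}. int (deg_in i f) \<le> int (card (A i)) - b i) \<and>
          int (card (nonzero_points n A f)) =
            prefilled_min n (\<lambda>i. int (card (A i))) b
              ((\<Sum>i=1..n. int (card (A i))) - d)))"
proof (intro conjI allI impI; (elim conjE)?)
  fix f :: "'a mpoly"
  assume f: "f \<in> polys n" "f \<noteq> 0"
    and deg: "\<forall>i\<in>{1..n}. int (deg_in i f) \<le> int (card (A i)) - b i"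
  obtain m where m: "m \<in> Poly_Mapping.keys f"
    "(\<Prod>i=1..n. card (A i) - Poly_Mapping.lookup m i) \<le> card (nonzero_points n A f)"
    using footprint_bound[of f n A] f assms(2,4) by blast
  \<comment> \<open>The degree bounds in the single indeterminates give
    \<open>b i \<le> y i\<close>; the total degree bounds the sum of \<open>y\<close> from
    below.\<close>
  define y where "y i = int (card (A i)) - int (Poly_Mapping.lookup m i)" for i
  have y: "0 \<le> b i \<and> b i \<le> y i \<and> y i \<le> int (card (A i))" if "i \<in> {1..n}" for i
    using deg_in_ge[OF m(1), of i] bspec[OF deg that] assms(5)[OF that] by (simp add: y_def)
  have "(\<Sum>i=1..n. int (card (A i))) - int (total_deg f) \<le> (\<Sum>i=1..n. y i)"
    using total_deg_ge[OF f(1) m(1)]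
    by (simp add: y_def sum_subtractf flip: of_nat_sum)
  then have "prefilled_min n (\<lambda>i. int (card (A i))) b
      ((\<Sum>i=1..n. int (card (A i))) - int (total_deg f)) \<le> (\<Prod>i=1..n. y i)"
    by (rule prefilled_min_le_prod[rotated]) (fact y)
  \<comment> \<open>The subtraction on naturals does not truncate, because \<open>y i\<close> is
    nonnegative.\<close>
  also have "\<dots> = (\<Prod>i=1..n. int (card (A i) - Poly_Mapping.lookup m i))"
    by (intro prod.cong refl) (use y in \<open>fastforce simp: y_def of_nat_diff\<close>)
  also have "\<dots> \<le> int (card (nonzero_points n A f))"
    using m(2) by (simp flip: of_nat_prod)
  finally show "int (card (nonzero_points n A f)) \<ge> prefilled_min n (\<lambda>i. int (card (A i))) b
      ((\<Sum>i=1..n. int (card (A i))) - int (total_deg f))" .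
next
  fix d :: int
  assume d: "0 \<le> d" "d \<le> (\<Sum>i=1..n. int (card (A i)) - b i)"
  let ?N = "(\<Sum>i=1..n. int (card (A i))) - d"
  obtain y where y: "\<And>i. i \<in> {1..n} \<Longrightarrow> b i \<le> y i \<and> y i \<le> int (card (A i))"
    "(\<Sum>i=1..n. y i) = ?N"
    "prefilled_min n (\<lambda>i. int (card (A i))) b ?N = (\<Prod>i=1..n. y i)"
    by (rule prefilled_min_attained[of n b "\<lambda>i. int (card (A i))" ?N])
      (use assms(5) d in \<open>auto simp: sum_subtractf\<close>)
  \<comment> \<open>Numbers of roots to prescribe, so that exactly \<open>y i\<close> elements of
    \<open>A i\<close> remain; \<open>y i \<le> card (A i)\<close> keeps \<open>nat\<close>
    faithful.\<close>
  define e where "e i = nat (int (card (A i)) - y i)" for i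
  have y_pos: "1 \<le> y i" if "i \<in> {1..n}" for i
    using y(1)[OF that] assms(5)[OF that] by simp
  have e: "int (e i) = int (card (A i)) - y i" if "i \<in> {1..n}" for i
    using y(1)[OF that] by (simp add: e_def)
  obtain f :: "'a mpoly" where f: "f \<in> polys n" "f \<noteq> 0"
    "total_deg f = (\<Sum>i=1..n. e i)"
    "\<And>i. i \<in> {1..n} \<Longrightarrow> deg_in i f \<le> e i"
    "card (nonzero_points n A f) = (\<Prod>i=1..n. card (A i) - e i)"
  proof (rule exists_card_nonzero_points[of n A e])
    show "e i \<le> card (A i)" if "i \<in> {1..n}" for i
      using e[OF that] y_pos[OF that] by linarith
  qed (use assms(2,4) in auto)
  have "int (total_deg f) = (\<Sum>i=1..n. int (card (A i)) - y i)"
    unfolding f(3) of_nat_sum by (rule sum.cong) (use e in auto)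
  then have "int (total_deg f) = d" using y(2) by (simp add: sum_subtractf)
  moreover have "int (deg_in i f) \<le> int (card (A i)) - b i" if "i \<in> {1..n}" for i
    using f(4)[OF that] e[OF that] y(1)[OF that] by linarith
  moreover have "int (card (nonzero_points n A f)) = (\<Prod>i=1..n. y i)"
    unfolding f(5) of_nat_prod
  proof (rule prod.cong)
    fix i assume i: "i \<in> {1..n}"
    show "int (card (A i) - e i) = y i" using e[OF i] y_pos[OF i] by linarith
  qed simp
  ultimately show "\<exists>f :: 'a mpoly. f \<in> polys n \<and> f \<noteq> 0 \<and> int (total_deg f) = d \<and>
      (\<forall>i\<in>{1..n}. int (deg_in i f) \<le> int (card (A i)) - b i) \<and>
      int (card (nonzero_points n A f)) = prefilled_min n (\<lambda>i. int (card (A i))) b ?N"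
    using f(1,2) y(3) by auto
qed

end
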